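(* Let $\Phi:\mathcal A\to R$ be an algebra homomorphism with finite expansions $\Theta_m:=\Phi(\vartheta_m)=x^m+\sum_{n>m}a_{m,n}x^n$ for $m\in\Lambda$. Suppose that for every nonzero $g\in R$, with $m=\mathrm{lead}\,g$, $$m\in\Lambda,\qquad \mathrm{Newt}(\Theta_m)\subseteq\mathrm{Newt}(g).$$ Then $\Phi$ is an isomorphism and, for every lattice polytope $P\subseteq L_{\mathbb R}$, $$R_P=\bigoplus_{\mathrm{Newt}(\Theta_m)\subseteq P}\mathbb C\,\Theta_m.$$ For every finite nonzero sum, $$\mathrm{Newt}\Bigl(\sum_mc_m\Theta_m\Bigr)=\mathrm{conv}\bigcup_{c_m\ne0}\mathrm{Newt}(\Theta_m).$$ In particular, every monomial valuation $v_w$ satisfies the minimum formula $v_w(\sum_mc_m\Theta_m)=\min_{c_m\ne0}v_w(\Theta_m)$.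
   Context: $L$ is a lattice, $R\subseteq\mathbb C[L]$ a $\mathbb C$-subalgebra of its group algebra with monomials $x^m$; $<$ is a translation-invariant total order on $L$, and $\mathrm{lead}\,g$ is the least exponent of a nonzero Laurent polynomial $g$. $\Lambda\subseteq L$ is a subset and $\mathcal A$ is a $\mathbb C$-algebra with basis $\{\vartheta_m:m\in\Lambda\}$. $\mathrm{supp}\,g$ is the set of exponents with nonzero coefficient and $\mathrm{Newt}(g)$ its convex hull in $L_{\mathbb R}$. For a lattice polytope $P$, $R_P=\{g\in R:\mathrm{supp}\,g\subseteq P\}$ (including $0$). For $w\in L_{\mathbb R}^*$, the monomial valuation is $v_w(\sum_mc_mx^m)=\min_{c_m\ne0}\langle w,m\rangle$. *)

theory Defs
  imports "HOL-Analysis.Analysis" "HOL-Library.Poly_Mapping"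
begin

text \<open>
  A lattice is a free abelian group of finite rank (rank 0 allowed). It is modelled by a type
  \<^typ>\<open>'l\<close> together with the canonical map into its real span \<open>L\<^sub>\<real>\<close>, modelled by a type
  \<^typ>\<open>'v\<close>: the map is additive and injective, and its image is the integer span of a finite
  basis of the real vector space.
\<close>

definition lattice_embedding :: "('l::ab_group_add \<Rightarrow> 'v::real_vector) \<Rightarrow> bool" where
  "lattice_embedding \<iota> \<longleftrightarrow>
     (\<forall>m n. \<iota> (m + n) = \<iota> m + \<iota> n) \<and> inj \<iota> \<and>
     (\<exists>B. finite B \<and> independent B \<and> span B = UNIV \<and>
          range \<iota> = {\<Sum>b\<in>B. of_int (k b) *\<^sub>R b | k :: 'v \<Rightarrow> int. True})"

definition lattice_polytope :: "('l \<Rightarrow> 'v::real_vector) \<Rightarrow> 'v set \<Rightarrow> bool" where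
  "lattice_polytope \<iota> P \<longleftrightarrow> (\<exists>V. finite V \<and> P = convex hull (\<iota> ` V))"

text \<open>All algebras are associative and unital; commutativity is not assumed.\<close>

locale complex_algebra = vector_space s
  for s :: "complex \<Rightarrow> 'a::ring_1 \<Rightarrow> 'a" +
  assumes mult_scale_left: "s c x * y = s c (x * y)"
    and mult_scale_right: "x * s c y = s c (x * y)"

definition complex_subalgebra :: "(complex \<Rightarrow> 'a::ring_1 \<Rightarrow> 'a) \<Rightarrow> 'a set \<Rightarrow> bool" where
  "complex_subalgebra s R \<longleftrightarrow>
     module.subspace s R \<and> 1 \<in> R \<and> (\<forall>x\<in>R. \<forall>y\<in>R. x * y \<in> R)"

definition complex_algebra_hom ::
  "(complex \<Rightarrow> 'a::ring_1 \<Rightarrow> 'a) \<Rightarrow> (complex \<Rightarrow> 'b::ring_1 \<Rightarrow> 'b) \<Rightarrow> 'b set \<Rightarrow> ('a \<Rightarrow> 'b) \<Rightarrow> bool" where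
  "complex_algebra_hom scaleA scaleB R \<Phi> \<longleftrightarrow>
     Vector_Spaces.linear scaleA scaleB \<Phi> \<and>
     (\<forall>x y. \<Phi> (x * y) = \<Phi> x * \<Phi> y) \<and> \<Phi> 1 = 1 \<and> (\<forall>x. \<Phi> x \<in> R)"

definition complex_algebra_iso ::
  "(complex \<Rightarrow> 'a::ring_1 \<Rightarrow> 'a) \<Rightarrow> (complex \<Rightarrow> 'b::ring_1 \<Rightarrow> 'b) \<Rightarrow> 'b set \<Rightarrow> ('a \<Rightarrow> 'b) \<Rightarrow> bool" where
  "complex_algebra_iso scaleA scaleB R \<Phi> \<longleftrightarrow>
     complex_algebra_hom scaleA scaleB R \<Phi> \<and> bij_betw \<Phi> UNIV R"

definition indexed_basis ::
  "(complex \<Rightarrow> 'a::ab_group_add \<Rightarrow> 'a) \<Rightarrow> 'i set \<Rightarrow> ('i \<Rightarrow> 'a) \<Rightarrow> bool" where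
  "indexed_basis s I b \<longleftrightarrow>
     inj_on b I \<and> \<not> module.dependent s (b ` I) \<and> module.span s (b ` I) = UNIV"

text \<open>
  \<open>W\<close> is the internal direct sum of the subspaces \<open>V i\<close>, \<open>i \<in> I\<close>: summation is a bijection from
  the external direct sum (finitely supported families) onto \<open>W\<close>.
\<close>

definition external_direct_sum :: "'i set \<Rightarrow> ('i \<Rightarrow> 'a::comm_monoid_add set) \<Rightarrow> ('i \<Rightarrow> 'a) set" where
  "external_direct_sum I V =
     {f. finite {i. f i \<noteq> 0} \<and> (\<forall>i\<in>I. f i \<in> V i) \<and> (\<forall>i. i \<notin> I \<longrightarrow> f i = 0)}"

definition is_internal_direct_sum ::
  "(complex \<Rightarrow> 'a::ab_group_add \<Rightarrow> 'a) \<Rightarrow> 'i set \<Rightarrow> ('i \<Rightarrow> 'a set) \<Rightarrow> 'a set \<Rightarrow> bool" where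
  "is_internal_direct_sum s I V W \<longleftrightarrow>
     (\<forall>i\<in>I. module.subspace s (V i)) \<and>
     bij_betw (\<lambda>f. \<Sum>i | f i \<noteq> 0. f i) (external_direct_sum I V) W"

text \<open>
  The group algebra \<open>\<complex>[L]\<close> is \<^typ>\<open>'l \<Rightarrow>\<^sub>0 complex\<close> with its convolution product; the monomial
  \<open>x\<^sup>m\<close> is \<open>Poly_Mapping.single m 1\<close>, the coefficient of \<open>x\<^sup>m\<close> in \<open>g\<close> is \<open>Poly_Mapping.lookup g m\<close>, and the
  support of \<open>g\<close> is \<open>Poly_Mapping.keys g\<close>.
\<close>

definition smult_pm :: "complex \<Rightarrow> ('l \<Rightarrow>\<^sub>0 complex) \<Rightarrow> ('l \<Rightarrow>\<^sub>0 complex)" where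
  "smult_pm c g = Poly_Mapping.map ((*) c) g"

lemma lookup_smult_pm: "Poly_Mapping.lookup (smult_pm c g) m = c * Poly_Mapping.lookup g m"
  by (simp add: smult_pm_def Poly_Mapping.map.rep_eq when_def)

lemma complex_algebra_smult_pm:
  "complex_algebra (smult_pm :: complex \<Rightarrow> ('l::ab_group_add \<Rightarrow>\<^sub>0 complex) \<Rightarrow> _)"
proof -
  have eq: "smult_pm c g = Poly_Mapping.single 0 c * g" for c and g :: "'l \<Rightarrow>\<^sub>0 complex"
    unfolding smult_pm_def by (rule mult_map_scale_conv_mult)
  show ?thesis
  proof
    fix c d :: complex and x y :: "'l \<Rightarrow>\<^sub>0 complex"
    show "smult_pm c (x + y) = smult_pm c x + smult_pm c y"
      by (simp add: eq distrib_left)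
    show "smult_pm (c + d) x = smult_pm c x + smult_pm d x"
      by (simp add: eq distrib_right single_add)
    show "smult_pm c (smult_pm d x) = smult_pm (c * d) x"
      by (simp add: eq mult_single flip: mult.assoc)
    show "smult_pm 1 x = x"
      by (simp add: eq)
    show "smult_pm c x * y = smult_pm c (x * y)"
      by (simp add: eq mult.assoc)
    show "x * smult_pm c y = smult_pm c (x * y)"
      by (simp add: eq mult.left_commute)
  qed
qed

text \<open>Only meaningful for nonzero \<open>g\<close>, as are the valuations below.\<close>

definition lead :: "('l::linorder \<Rightarrow>\<^sub>0 complex) \<Rightarrow> 'l" where
  "lead g = Min (Poly_Mapping.keys g)"

definition Newt :: "('l \<Rightarrow> 'v::real_vector) \<Rightarrow> ('l \<Rightarrow>\<^sub>0 complex) \<Rightarrow> 'v set" where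
  "Newt \<iota> g = convex hull (\<iota> ` Poly_Mapping.keys g)"

definition supported_part ::
  "('l \<Rightarrow> 'v::real_vector) \<Rightarrow> ('l \<Rightarrow>\<^sub>0 complex) set \<Rightarrow> 'v set \<Rightarrow> ('l \<Rightarrow>\<^sub>0 complex) set" where
  "supported_part \<iota> R P = {g \<in> R. \<iota> ` Poly_Mapping.keys g \<subseteq> P}"

definition monomial_val :: "('l \<Rightarrow> 'v::real_vector) \<Rightarrow> ('v \<Rightarrow> real) \<Rightarrow> ('l \<Rightarrow>\<^sub>0 complex) \<Rightarrow> real" where
  "monomial_val \<iota> w g = Min ((\<lambda>m. w (\<iota> m)) ` Poly_Mapping.keys g)"

end

theory Submission
  imports Defs
begin

text \<open>
  Each \<open>\<Theta>\<^sub>m\<close> has leading term \<open>x\<^sup>m\<close>, so a combination \<open>\<Sum>c\<^sub>m\<Theta>\<^sub>m\<close> has the coefficient \<open>c\<^sub>k\<close> at the least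
  index \<open>k\<close> that occurs in it. Hence the \<open>\<Theta>\<^sub>m\<close> are linearly independent and \<open>\<Phi>\<close> is injective.

  Conversely, let \<open>g \<in> R\<close> be nonzero with support in a polytope \<open>P\<close>, and let \<open>m = lead g\<close>. Subtracting
  the multiple of \<open>\<Theta>\<^sub>m\<close> that cancels the term of \<open>g\<close> at \<open>m\<close> leaves an element of \<open>R\<close> which is again
  supported in \<open>P\<close>, because \<open>Newt \<Theta>\<^sub>m \<subseteq> Newt g \<subseteq> P\<close>, and whose exponents all exceed \<open>m\<close>. A polytope
  contains only finitely many lattice points (\<open>finite_lattice_points\<close>), so this division stops, and
  \<open>g\<close> is a combination of those \<open>\<Theta>\<^sub>m\<close> with \<open>Newt \<Theta>\<^sub>m \<subseteq> P\<close> (\<open>lincomb_exists\<close>).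
  This gives surjectivity of \<open>\<Phi>\<close> and the direct sum decomposition of \<open>R\<^sub>P\<close>.

  Taking \<open>P = Newt g\<close> and using uniqueness of coefficients, every \<open>\<Theta>\<^sub>m\<close> that occurs in \<open>g\<close> has its
  Newton polytope inside \<open>Newt g\<close>: no cancellation can shrink the hull
  (\<open>Newt_subset_Newt_lincomb\<close>). The formulas for \<open>Newt\<close> and for the monomial valuations follow.
\<close>

section \<open>Lattice points of polytopes\<close>

text \<open>
  In coordinates with respect to a lattice basis, lattice points have integer coordinates, and a
  bound for the absolute values of the coordinates on a finite set holds on its convex hull too. The
  points of \<open>V\<close> need not lie in the lattice.
\<close>

lemma finite_lattice_points:
  fixes \<iota> :: "'l::ab_group_add \<Rightarrow> 'v::real_vector"
  assumes "lattice_embedding \<iota>" and "finite V"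
  shows "finite {n. \<iota> n \<in> convex hull V}"
proof -
  from assms(1) obtain B where inj: "inj \<iota>" and B: "finite B" "independent B" "span B = UNIV"
    and rng: "range \<iota> = {\<Sum>b\<in>B. of_int (k b) *\<^sub>R b | k :: 'v \<Rightarrow> int. True}"
    unfolding lattice_embedding_def by auto
  define r where "r = (\<lambda>b v. representation B v b)"
  have lin: "linear (r b)" for b
    unfolding r_def by (rule linearI)
      (use B in \<open>auto simp: real_vector.representation_add real_vector.representation_scale\<close>)
  have rsum: "(\<Sum>b\<in>B. r b v *\<^sub>R b) = v" for v
    unfolding r_def using B by (intro real_vector.sum_representation_eq) auto
  have rint: "r b (\<iota> n) \<in> \<int>" if "b \<in> B" for b n
  proof -
    from rng obtain k :: "'v \<Rightarrow> int" where k: "\<iota> n = (\<Sum>b\<in>B. of_int (k b) *\<^sub>R b)"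
      by blast
    have "r b (\<iota> n) = (\<Sum>b'\<in>B. of_int (k b') * r b b')"
      using lin[of b] by (simp add: k linear_sum linear_scale)
    also have "\<dots> = (\<Sum>b'\<in>B. of_int (k b') * (if b' = b then 1 else 0))"
      unfolding r_def using B
      by (intro sum.cong refl) (simp add: real_vector.representation_basis)
    also have "\<dots> = of_int (k b)"
      using B(1) that by (simp add: if_distrib cong: if_cong)
    finally show ?thesis by simp
  qed
  \<comment> \<open>A crude common bound for all coordinates of all points of \<open>V\<close>.\<close>
  define M where "M = (\<Sum>b\<in>B. \<Sum>v\<in>V. \<bar>r b v\<bar>)"
  have bound: "\<bar>r b x\<bar> \<le> M" if "b \<in> B" "x \<in> convex hull V" for b x
  proof -
    have V: "\<bar>r b v\<bar> \<le> M" if "v \<in> V" for v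
    proof -
      have "\<bar>r b v\<bar> \<le> (\<Sum>v\<in>V. \<bar>r b v\<bar>)"
        using assms(2) that by (intro member_le_sum) auto
      also have "\<dots> \<le> M"
        unfolding M_def using B \<open>b \<in> B\<close>
        by (intro member_le_sum[where f = "\<lambda>b. \<Sum>v\<in>V. \<bar>r b v\<bar>"]) (auto intro: sum_nonneg)
      finally show ?thesis .
    qed
    have "convex hull V \<subseteq> r b -` {-M..M}"
      using V lin by (intro hull_minimal convex_linear_vimage) (force simp: abs_le_iff)+
    then show ?thesis using that by (auto simp: abs_le_iff)
  qed
  define f where "f = (\<lambda>n. restrict (\<lambda>b. \<lfloor>r b (\<iota> n)\<rfloor>) B)"
  have "inj_on f {n. \<iota> n \<in> convex hull V}"
  proof (rule inj_onI)
    fix n n' assume "f n = f n'"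
    then have "r b (\<iota> n) = r b (\<iota> n')" if "b \<in> B" for b
      using that rint[OF that, of n] rint[OF that, of n']
      by (auto simp: f_def restrict_def fun_eq_iff elim!: Ints_cases) (metis floor_of_int)
    then have "\<iota> n = \<iota> n'"
      using rsum[of "\<iota> n"] rsum[of "\<iota> n'"] by (metis (no_types, lifting) sum.cong)
    then show "n = n'" using inj by (simp add: inj_eq)
  qed
  moreover have "f ` {n. \<iota> n \<in> convex hull V} \<subseteq> B \<rightarrow>\<^sub>E {\<lfloor>-M\<rfloor>..\<lfloor>M\<rfloor>}"
  proof clarify
    fix n assume n: "\<iota> n \<in> convex hull V"
    have "\<lfloor>r b (\<iota> n)\<rfloor> \<in> {\<lfloor>-M\<rfloor>..\<lfloor>M\<rfloor>}" if "b \<in> B" for b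
      using bound[OF that n] by (auto simp: abs_le_iff intro!: floor_mono)
    then show "f n \<in> B \<rightarrow>\<^sub>E {\<lfloor>-M\<rfloor>..\<lfloor>M\<rfloor>}"
      unfolding f_def by auto
  qed
  ultimately show ?thesis
    using B by (meson finite_PiE finite_atLeastAtMost_int finite_imageD finite_subset)
qed

section \<open>Finite linear combinations of a family\<close>

text \<open>
  The combination of the family \<open>b\<close> with coefficients \<open>c\<close>; a finitely supported function serves as
  coefficient family, so that coefficients can be added and compared.
\<close>

definition lincomb ::
  "(complex \<Rightarrow> 'b::ab_group_add \<Rightarrow> 'b) \<Rightarrow> ('i \<Rightarrow> 'b) \<Rightarrow> ('i \<Rightarrow>\<^sub>0 complex) \<Rightarrow> 'b" where
  "lincomb s b c = (\<Sum>m\<in>Poly_Mapping.keys c. s (Poly_Mapping.lookup c m) (b m))"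

context
  fixes s :: "complex \<Rightarrow> 'b::ab_group_add \<Rightarrow> 'b"
  assumes vs: "vector_space s"
begin

interpretation vector_space s by (rule vs)

lemma lincomb_superset:
  assumes "finite S" "Poly_Mapping.keys c \<subseteq> S"
  shows "lincomb s b c = (\<Sum>m\<in>S. s (Poly_Mapping.lookup c m) (b m))"
  unfolding lincomb_def using assms
  by (intro sum.mono_neutral_left) (auto simp: in_keys_iff)

lemma lincomb_single: "lincomb s b (Poly_Mapping.single m k) = s k (b m)"
  using lincomb_superset[of "{m}" "Poly_Mapping.single m k" b] by simp

lemma lincomb_add: "lincomb s b (c + d) = lincomb s b c + lincomb s b d"
proof -
  define S where "S = Poly_Mapping.keys c \<union> Poly_Mapping.keys d"
  have S: "finite S" "Poly_Mapping.keys c \<subseteq> S" "Poly_Mapping.keys d \<subseteq> S"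
    "Poly_Mapping.keys (c + d) \<subseteq> S"
    unfolding S_def using Poly_Mapping.keys_add[of c d] by auto
  show ?thesis
    using S by (simp add: lincomb_superset[OF S(1)] lookup_add scale_left_distrib sum.distrib)
qed

lemma lincomb_diff: "lincomb s b (c - d) = lincomb s b c - lincomb s b d"
  using lincomb_add[of b "c - d" d] by simp

lemma lincomb_in_subspace:
  assumes "subspace W" "\<And>m. m \<in> Poly_Mapping.keys c \<Longrightarrow> b m \<in> W"
  shows "lincomb s b c \<in> W"
  unfolding lincomb_def using assms by (intro subspace_sum subspace_scale) auto

lemma span_image_lincomb:
  assumes "x \<in> span (b ` I)"
  shows "\<exists>c. Poly_Mapping.keys c \<subseteq> I \<and> x = lincomb s b c"
  using assms
proof (induction rule: span_induct_alt)
  case base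
  show ?case by (rule exI[of _ 0]) (simp add: lincomb_def)
next
  case (step k v y)
  then obtain c m where c: "Poly_Mapping.keys c \<subseteq> I" "y = lincomb s b c" and m: "m \<in> I" "v = b m"
    by auto
  have "Poly_Mapping.keys (Poly_Mapping.single m k + c) \<subseteq> I"
    using Poly_Mapping.keys_add[of "Poly_Mapping.single m k" c] c m
    by (auto split: if_splits)
  moreover have "s k v + y = lincomb s b (Poly_Mapping.single m k + c)"
    by (simp add: lincomb_add lincomb_single c m)
  ultimately show ?case by blast
qed

end

lemma linear_lincomb:
  assumes "Vector_Spaces.linear s t f"
  shows "f (lincomb s b c) = lincomb t (\<lambda>m. f (b m)) c"
proof -
  interpret f: Vector_Spaces.linear s t f by (rule assms)
  show ?thesis unfolding lincomb_def by (simp add: f.sum f.scale)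
qed

interpretation pm: complex_algebra "smult_pm :: complex \<Rightarrow> ('l::ab_group_add \<Rightarrow>\<^sub>0 complex) \<Rightarrow> _"
  by (rule complex_algebra_smult_pm)

lemmas pm_vector_space = pm.vector_space_axioms

lemma lookup_lincomb:
  "Poly_Mapping.lookup (lincomb smult_pm \<Theta> c) n
     = (\<Sum>m\<in>Poly_Mapping.keys c. Poly_Mapping.lookup c m * Poly_Mapping.lookup (\<Theta> m) n)"
  unfolding lincomb_def by (simp add: lookup_sum lookup_smult_pm)

lemma keys_lincomb:
  "Poly_Mapping.keys (lincomb smult_pm \<Theta> c)
     \<subseteq> (\<Union>m\<in>Poly_Mapping.keys c. Poly_Mapping.keys (\<Theta> m))"
proof
  fix n assume "n \<in> Poly_Mapping.keys (lincomb smult_pm \<Theta> c)"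
  then have "(\<Sum>m\<in>Poly_Mapping.keys c. Poly_Mapping.lookup c m * Poly_Mapping.lookup (\<Theta> m) n) \<noteq> 0"
    by (simp add: in_keys_iff lookup_lincomb)
  then obtain m where "m \<in> Poly_Mapping.keys c" "Poly_Mapping.lookup (\<Theta> m) n \<noteq> 0"
    by (metis (no_types, lifting) mult_zero_right sum.neutral)
  then show "n \<in> (\<Union>m\<in>Poly_Mapping.keys c. Poly_Mapping.keys (\<Theta> m))"
    by (auto simp: in_keys_iff)
qed

section \<open>Families with leading monomials\<close>

text \<open>
  Each \<open>\<Theta>\<^sub>m\<close> with \<open>m \<in> \<Lambda>\<close> is \<open>x\<^sup>m\<close> plus terms with larger exponents; nothing is required of \<open>\<Theta>\<^sub>m\<close> for
  \<open>m \<notin> \<Lambda>\<close>.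
\<close>

locale leading_monomial_family =
  fixes \<Lambda> :: "'l::linordered_ab_group_add set" and \<Theta> :: "'l \<Rightarrow> ('l \<Rightarrow>\<^sub>0 complex)"
  assumes coeff_lead: "m \<in> \<Lambda> \<Longrightarrow> Poly_Mapping.lookup (\<Theta> m) m = 1"
    and coeff_below: "m \<in> \<Lambda> \<Longrightarrow> n < m \<Longrightarrow> Poly_Mapping.lookup (\<Theta> m) n = 0"
begin

lemma index_in_keys: "m \<in> \<Lambda> \<Longrightarrow> m \<in> Poly_Mapping.keys (\<Theta> m)"
  by (simp add: in_keys_iff coeff_lead)

lemma lincomb_nonzero:
  assumes "Poly_Mapping.keys c \<subseteq> \<Lambda>" "c \<noteq> 0"
  shows "lincomb smult_pm \<Theta> c \<noteq> 0"
proof -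
  define k where "k = Min (Poly_Mapping.keys c)"
  have k: "k \<in> Poly_Mapping.keys c" "\<And>m. m \<in> Poly_Mapping.keys c \<Longrightarrow> k \<le> m"
    unfolding k_def using assms by auto
  have "Poly_Mapping.lookup (lincomb smult_pm \<Theta> c) k
      = (\<Sum>m\<in>Poly_Mapping.keys c. if m = k then Poly_Mapping.lookup c k else 0)"
    unfolding lookup_lincomb
  proof (intro sum.cong refl)
    fix m assume m: "m \<in> Poly_Mapping.keys c"
    then show "Poly_Mapping.lookup c m * Poly_Mapping.lookup (\<Theta> m) k
        = (if m = k then Poly_Mapping.lookup c k else 0)"
      using k(2)[OF m] assms(1) by (auto simp: coeff_lead coeff_below le_less)
  qed
  also have "\<dots> = Poly_Mapping.lookup c k"
    using k by simp
  also have "\<dots> \<noteq> 0"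
    using k by (simp add: in_keys_iff)
  finally show ?thesis by auto
qed

lemma lincomb_inject:
  assumes "Poly_Mapping.keys c \<subseteq> \<Lambda>" "Poly_Mapping.keys d \<subseteq> \<Lambda>"
    and "lincomb smult_pm \<Theta> c = lincomb smult_pm \<Theta> d"
  shows "c = d"
proof -
  have "Poly_Mapping.keys (c - d) \<subseteq> \<Lambda>"
    using Poly_Mapping.keys_diff[of c d] assms by blast
  moreover have "lincomb smult_pm \<Theta> (c - d) = 0"
    using assms by (simp add: lincomb_diff[OF pm_vector_space])
  ultimately show ?thesis
    using lincomb_nonzero[of "c - d"] by auto
qed

lemma span_singleton_eq:
  assumes "m \<in> \<Lambda>" "g \<in> module.span smult_pm {\<Theta> m}"
  shows "g = smult_pm (Poly_Mapping.lookup g m) (\<Theta> m)"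
proof -
  from assms(2) obtain k where "g = smult_pm k (\<Theta> m)"
    by (auto simp: pm.span_singleton)
  then show ?thesis
    using assms(1) by (simp add: lookup_smult_pm coeff_lead)
qed

end

section \<open>Division inside a polytope\<close>

text \<open>
  The \<open>\<Theta>\<^sub>m\<close> lie in a subspace \<open>R\<close> of \<open>\<complex>[L]\<close>, and the leading term of every nonzero \<open>g \<in> R\<close> can be
  cancelled by a multiple of some \<open>\<Theta>\<^sub>m\<close> without leaving the Newton polytope of \<open>g\<close>. Closure of \<open>R\<close>
  under products plays no role in the division.
\<close>

locale newton_controlled_family = leading_monomial_family \<Lambda> \<Theta>
  for \<Lambda> :: "'l::linordered_ab_group_add set" and \<Theta> :: "'l \<Rightarrow> ('l \<Rightarrow>\<^sub>0 complex)" +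
  fixes \<iota> :: "'l \<Rightarrow> 'v::real_vector" and R :: "('l \<Rightarrow>\<^sub>0 complex) set"
  assumes lattice: "lattice_embedding \<iota>"
    and subspace_R: "module.subspace smult_pm R"
    and family_in_R: "m \<in> \<Lambda> \<Longrightarrow> \<Theta> m \<in> R"
    and lead_in: "g \<in> R \<Longrightarrow> g \<noteq> 0 \<Longrightarrow> lead g \<in> \<Lambda>"
    and Newt_lead: "g \<in> R \<Longrightarrow> g \<noteq> 0 \<Longrightarrow> Newt \<iota> (\<Theta> (lead g)) \<subseteq> Newt \<iota> g"
begin

text \<open>
  Division by the \<open>\<Theta>\<^sub>m\<close>: cancel the leading term and repeat. Each step removes a point from the finite
  set of lattice points of \<open>P\<close> that lie at or above some exponent of the remainder.
\<close>

lemma lincomb_exists: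
  assumes fin: "finite {n. \<iota> n \<in> P}" and conv: "convex P"
    and "g \<in> R" "\<iota> ` Poly_Mapping.keys g \<subseteq> P"
  shows "\<exists>c. Poly_Mapping.keys c \<subseteq> {m \<in> \<Lambda>. Newt \<iota> (\<Theta> m) \<subseteq> P} \<and> g = lincomb smult_pm \<Theta> c"
  using assms(3,4)
  \<comment> \<open>Quantifying over the exponents, instead of using \<open>lead g\<close>, makes the measure \<open>0\<close> for \<open>g = 0\<close>.\<close>
proof (induction "card {n. \<iota> n \<in> P \<and> (\<exists>k\<in>Poly_Mapping.keys g. k \<le> n)}" arbitrary: g
    rule: less_induct)
  case less
  show ?case
  proof (cases "g = 0")
    case True
    then show ?thesis by (intro exI[of _ 0]) (simp add: lincomb_def)
  next
    case False
    define m where "m = lead g"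
    define a where "a = Poly_Mapping.lookup g m"
    define h where "h = g - smult_pm a (\<Theta> m)"
    have m: "m \<in> \<Lambda>" "m \<in> Poly_Mapping.keys g" "\<And>n. n \<in> Poly_Mapping.keys g \<Longrightarrow> m \<le> n"
      unfolding m_def using lead_in[OF less.prems(1) False] False by (auto simp: lead_def)
    have N: "Newt \<iota> (\<Theta> m) \<subseteq> P"
    proof -
      have "Newt \<iota> g \<subseteq> P"
        unfolding Newt_def using less.prems conv by (intro hull_minimal) auto
      then show ?thesis
        using Newt_lead[OF less.prems(1) False] unfolding m_def by blast
    qed
    have kP: "\<iota> ` Poly_Mapping.keys (\<Theta> m) \<subseteq> P"
      using N hull_subset[of "\<iota> ` Poly_Mapping.keys (\<Theta> m)" convex] unfolding Newt_def by blast
    have hR: "h \<in> R"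
      unfolding h_def using subspace_R less.prems(1) family_in_R[OF m(1)]
      by (intro pm.subspace_diff pm.subspace_scale)
    have hkeys: "Poly_Mapping.keys h \<subseteq> Poly_Mapping.keys g \<union> Poly_Mapping.keys (\<Theta> m)"
      unfolding h_def by (auto simp: in_keys_iff lookup_minus lookup_smult_pm)
    have hgt: "m < n" if "n \<in> Poly_Mapping.keys h" for n
    proof (rule ccontr)
      assume "\<not> m < n"
      then consider "n = m" | "n < m" by force
      then have "Poly_Mapping.lookup h n = 0"
      proof cases
        case 1
        then show ?thesis
          by (simp add: h_def lookup_minus lookup_smult_pm coeff_lead[OF m(1)] a_def)
      next
        case 2
        then have "n \<notin> Poly_Mapping.keys g" using m(3) by force
        with 2 show ?thesis
          by (simp add: h_def lookup_minus lookup_smult_pm coeff_below[OF m(1)] in_keys_iff)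
      qed
      with that show False by (simp add: in_keys_iff)
    qed
    have "{n. \<iota> n \<in> P \<and> (\<exists>k\<in>Poly_Mapping.keys h. k \<le> n)}
        \<subset> {n. \<iota> n \<in> P \<and> (\<exists>k\<in>Poly_Mapping.keys g. k \<le> n)}"
    proof
      show "{n. \<iota> n \<in> P \<and> (\<exists>k\<in>Poly_Mapping.keys h. k \<le> n)}
          \<subseteq> {n. \<iota> n \<in> P \<and> (\<exists>k\<in>Poly_Mapping.keys g. k \<le> n)}"
        using m(2) hgt by (auto intro!: bexI[of _ m] dest!: hgt)
      have "m \<in> {n. \<iota> n \<in> P \<and> (\<exists>k\<in>Poly_Mapping.keys g. k \<le> n)}"
        using m(2) less.prems(2) by auto
      moreover have "m \<notin> {n. \<iota> n \<in> P \<and> (\<exists>k\<in>Poly_Mapping.keys h. k \<le> n)}"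
        using hgt by force
      ultimately show "{n. \<iota> n \<in> P \<and> (\<exists>k\<in>Poly_Mapping.keys h. k \<le> n)}
          \<noteq> {n. \<iota> n \<in> P \<and> (\<exists>k\<in>Poly_Mapping.keys g. k \<le> n)}"
        by blast
    qed
    then have "card {n. \<iota> n \<in> P \<and> (\<exists>k\<in>Poly_Mapping.keys h. k \<le> n)}
        < card {n. \<iota> n \<in> P \<and> (\<exists>k\<in>Poly_Mapping.keys g. k \<le> n)}"
      by (intro psubset_card_mono) (use fin in \<open>auto intro: finite_subset[rotated]\<close>)
    moreover have "\<iota> ` Poly_Mapping.keys h \<subseteq> P"
      using hkeys kP less.prems(2) by blast
    ultimately obtain c where c: "Poly_Mapping.keys c \<subseteq> {m \<in> \<Lambda>. Newt \<iota> (\<Theta> m) \<subseteq> P}"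
      "h = lincomb smult_pm \<Theta> c"
      using less.hyps hR by blast
    have "Poly_Mapping.keys (Poly_Mapping.single m a + c) \<subseteq> {m \<in> \<Lambda>. Newt \<iota> (\<Theta> m) \<subseteq> P}"
      using Poly_Mapping.keys_add[of "Poly_Mapping.single m a" c] c(1) m(1) N
      by (auto split: if_splits)
    moreover have "g = lincomb smult_pm \<Theta> (Poly_Mapping.single m a + c)"
      using c(2) unfolding h_def
      by (simp add: lincomb_add[OF pm_vector_space] lincomb_single[OF pm_vector_space]
          algebra_simps)
    ultimately show ?thesis by blast
  qed
qed

lemma lincomb_in_R: "Poly_Mapping.keys c \<subseteq> \<Lambda> \<Longrightarrow> lincomb smult_pm \<Theta> c \<in> R"
  using subspace_R family_in_R by (intro lincomb_in_subspace[OF pm_vector_space]) auto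

lemma lincomb_exists_Newt:
  assumes "g \<in> R"
  shows "\<exists>c. Poly_Mapping.keys c \<subseteq> {m \<in> \<Lambda>. Newt \<iota> (\<Theta> m) \<subseteq> Newt \<iota> g} \<and> g = lincomb smult_pm \<Theta> c"
proof (rule lincomb_exists)
  show "finite {n. \<iota> n \<in> Newt \<iota> g}"
    unfolding Newt_def by (rule finite_lattice_points[OF lattice]) simp
  show "convex (Newt \<iota> g)" unfolding Newt_def by simp
  show "\<iota> ` Poly_Mapping.keys g \<subseteq> Newt \<iota> g" unfolding Newt_def by (rule hull_subset)
qed fact

section \<open>Newton polytopes and valuations of combinations\<close>

text \<open>
  Dividing \<open>\<Sum>c\<^sub>m\<Theta>\<^sub>m\<close> inside its own Newton polytope recovers the \<open>c\<^sub>m\<close>, as coefficients are unique.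
\<close>

lemma Newt_subset_Newt_lincomb:
  assumes "Poly_Mapping.keys c \<subseteq> \<Lambda>" "m \<in> Poly_Mapping.keys c"
  shows "Newt \<iota> (\<Theta> m) \<subseteq> Newt \<iota> (lincomb smult_pm \<Theta> c)"
proof -
  obtain d where d: "Poly_Mapping.keys d \<subseteq> {m \<in> \<Lambda>. Newt \<iota> (\<Theta> m) \<subseteq> Newt \<iota> (lincomb smult_pm \<Theta> c)}"
    "lincomb smult_pm \<Theta> c = lincomb smult_pm \<Theta> d"
    using lincomb_exists_Newt[OF lincomb_in_R[OF assms(1)]] by blast
  have "c = d"
    using assms(1) d(1) by (intro lincomb_inject[OF _ _ d(2)]) auto
  then show ?thesis using d(1) assms(2) by auto
qed

lemma Newt_lincomb:
  assumes "Poly_Mapping.keys c \<subseteq> \<Lambda>"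
  shows "Newt \<iota> (lincomb smult_pm \<Theta> c) = convex hull (\<Union>m\<in>Poly_Mapping.keys c. Newt \<iota> (\<Theta> m))"
proof
  have "\<iota> ` Poly_Mapping.keys (lincomb smult_pm \<Theta> c) \<subseteq> (\<Union>m\<in>Poly_Mapping.keys c. Newt \<iota> (\<Theta> m))"
    using keys_lincomb[of \<Theta> c] unfolding Newt_def by (fastforce intro: hull_inc)
  then show "Newt \<iota> (lincomb smult_pm \<Theta> c) \<subseteq> convex hull (\<Union>m\<in>Poly_Mapping.keys c. Newt \<iota> (\<Theta> m))"
    unfolding Newt_def[of \<iota> "lincomb smult_pm \<Theta> c"] by (rule hull_mono)
  have "convex (Newt \<iota> (lincomb smult_pm \<Theta> c))"
    unfolding Newt_def by simp
  then show "convex hull (\<Union>m\<in>Poly_Mapping.keys c. Newt \<iota> (\<Theta> m)) \<subseteq> Newt \<iota> (lincomb smult_pm \<Theta> c)"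
    using Newt_subset_Newt_lincomb[OF assms] by (intro hull_minimal) auto
qed

lemma monomial_val_lincomb:
  assumes c: "Poly_Mapping.keys c \<subseteq> \<Lambda>" "c \<noteq> 0" and w: "linear w"
  shows "monomial_val \<iota> w (lincomb smult_pm \<Theta> c)
    = Min ((\<lambda>m. monomial_val \<iota> w (\<Theta> m)) ` Poly_Mapping.keys c)"
proof (rule antisym)
  let ?g = "lincomb smult_pm \<Theta> c"
  have g: "Poly_Mapping.keys ?g \<noteq> {}"
    using lincomb_nonzero[OF c] by simp
  have ne: "Poly_Mapping.keys (\<Theta> m) \<noteq> {}" if "m \<in> Poly_Mapping.keys c" for m
    using index_in_keys[of m] that c(1) by blast
  \<comment> \<open>A linear form attains its minimum over a hull on the generating set.\<close>
  have below: "monomial_val \<iota> w ?g \<le> w x" if "x \<in> Newt \<iota> ?g" for x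
  proof -
    have "convex hull (\<iota> ` Poly_Mapping.keys ?g) \<subseteq> w -` {monomial_val \<iota> w ?g..}"
      using w by (intro hull_minimal convex_linear_vimage) (auto simp: monomial_val_def)
    then show ?thesis using that by (auto simp: Newt_def)
  qed
  show "monomial_val \<iota> w ?g \<le> Min ((\<lambda>m. monomial_val \<iota> w (\<Theta> m)) ` Poly_Mapping.keys c)"
  proof (rule Min.boundedI)
    fix y assume "y \<in> (\<lambda>m. monomial_val \<iota> w (\<Theta> m)) ` Poly_Mapping.keys c"
    then obtain m where m: "m \<in> Poly_Mapping.keys c" "y = monomial_val \<iota> w (\<Theta> m)" by blast
    have "monomial_val \<iota> w ?g \<le> w (\<iota> n)" if "n \<in> Poly_Mapping.keys (\<Theta> m)" for n
    proof -
      have "\<iota> n \<in> Newt \<iota> (\<Theta> m)"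
        unfolding Newt_def using that by (simp add: hull_inc)
      then show ?thesis
        using Newt_subset_Newt_lincomb[OF c(1) m(1)] below by blast
    qed
    then show "monomial_val \<iota> w ?g \<le> y"
      using ne[OF m(1)] unfolding m(2) monomial_val_def[of \<iota> w "\<Theta> m"] by simp
  qed (use c in auto)
  show "Min ((\<lambda>m. monomial_val \<iota> w (\<Theta> m)) ` Poly_Mapping.keys c) \<le> monomial_val \<iota> w ?g"
    unfolding monomial_val_def[of \<iota> w ?g]
  proof (rule Min.boundedI)
    fix y assume "y \<in> (\<lambda>m. w (\<iota> m)) ` Poly_Mapping.keys ?g"
    then obtain n m where "y = w (\<iota> n)" and m: "m \<in> Poly_Mapping.keys c" "n \<in> Poly_Mapping.keys (\<Theta> m)"
      using keys_lincomb[of \<Theta> c] by blast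
    then have "monomial_val \<iota> w (\<Theta> m) \<le> y"
      by (simp add: monomial_val_def)
    moreover have "Min ((\<lambda>m. monomial_val \<iota> w (\<Theta> m)) ` Poly_Mapping.keys c) \<le> monomial_val \<iota> w (\<Theta> m)"
      using m(1) by simp
    ultimately show "Min ((\<lambda>m. monomial_val \<iota> w (\<Theta> m)) ` Poly_Mapping.keys c) \<le> y"
      by linarith
  qed (use g in auto)
qed

section \<open>The elements supported in a polytope\<close>

lemma supported_part_eq_lincombs:
  assumes "lattice_polytope \<iota> P"
  shows "supported_part \<iota> R P
    = lincomb smult_pm \<Theta> ` {c. Poly_Mapping.keys c \<subseteq> {m \<in> \<Lambda>. Newt \<iota> (\<Theta> m) \<subseteq> P}}"
proof -
  from assms obtain V where V: "finite V" "P = convex hull (\<iota> ` V)"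
    unfolding lattice_polytope_def by auto
  have P: "finite {n. \<iota> n \<in> P}" "convex P"
    unfolding V(2) using finite_lattice_points[OF lattice, of "\<iota> ` V"] V(1) by simp_all
  have "lincomb smult_pm \<Theta> c \<in> supported_part \<iota> R P"
    if c: "Poly_Mapping.keys c \<subseteq> {m \<in> \<Lambda>. Newt \<iota> (\<Theta> m) \<subseteq> P}" for c
  proof -
    have "\<iota> n \<in> P" if "n \<in> Poly_Mapping.keys (lincomb smult_pm \<Theta> c)" for n
    proof -
      from that keys_lincomb[of \<Theta> c]
      obtain m where "m \<in> Poly_Mapping.keys c" "n \<in> Poly_Mapping.keys (\<Theta> m)"
        by blast
      then show ?thesis
        using c hull_inc[of "\<iota> n" "\<iota> ` Poly_Mapping.keys (\<Theta> m)" convex] unfolding Newt_def by blast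
    qed
    then show ?thesis
      using lincomb_in_R[of c] c unfolding supported_part_def by blast
  qed
  moreover have "g \<in> lincomb smult_pm \<Theta> ` {c. Poly_Mapping.keys c \<subseteq> {m \<in> \<Lambda>. Newt \<iota> (\<Theta> m) \<subseteq> P}}"
    if "g \<in> supported_part \<iota> R P" for g
    using lincomb_exists[OF P, of g] that unfolding supported_part_def by (simp add: image_iff)
  ultimately show ?thesis
    by (intro subset_antisym subsetI) auto
qed

text \<open>
  An element \<open>f\<close> of the external direct sum of the lines \<open>\<complex> \<Theta>\<^sub>m\<close> is encoded by the coefficients
  \<open>[x\<^sup>m] f\<^sub>m\<close>, because \<open>\<Theta>\<^sub>m\<close> has coefficient \<open>1\<close> at \<open>x\<^sup>m\<close>.
\<close>

lemma supported_part_direct_sum: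
  assumes "lattice_polytope \<iota> P"
  shows "is_internal_direct_sum smult_pm {m \<in> \<Lambda>. Newt \<iota> (\<Theta> m) \<subseteq> P}
    (\<lambda>m. module.span smult_pm {\<Theta> m}) (supported_part \<iota> R P)"
proof -
  let ?I = "{m \<in> \<Lambda>. Newt \<iota> (\<Theta> m) \<subseteq> P}"
  let ?C = "{c :: 'l \<Rightarrow>\<^sub>0 complex. Poly_Mapping.keys c \<subseteq> ?I}"
  let ?E = "external_direct_sum ?I (\<lambda>m. module.span smult_pm {\<Theta> m})"
  let ?\<phi> = "\<lambda>c m. smult_pm (Poly_Mapping.lookup c m) (\<Theta> m)"
  let ?\<sigma> = "\<lambda>f::'l \<Rightarrow> ('l \<Rightarrow>\<^sub>0 complex). \<Sum>i | f i \<noteq> 0. f i"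
  have \<phi>_supp: "{m. ?\<phi> c m \<noteq> 0} = Poly_Mapping.keys c" if "c \<in> ?C" for c
  proof -
    have "\<Theta> m \<noteq> 0" if "m \<in> Poly_Mapping.keys c" for m
      using index_in_keys[of m] \<open>c \<in> ?C\<close> that by fastforce
    then show ?thesis by (auto simp: in_keys_iff)
  qed
  \<comment> \<open>Up to the bijection \<open>?\<phi>\<close>, summation of families is \<open>lincomb\<close>, which is injective.\<close>
  have "bij_betw ?\<phi> ?C ?E"
  proof (rule bij_betwI')
    fix c d assume "c \<in> ?C" "d \<in> ?C"
    show "?\<phi> c = ?\<phi> d \<longleftrightarrow> c = d"
    proof
      assume eq: "?\<phi> c = ?\<phi> d"
      show "c = d"
      proof (rule poly_mapping_eqI)
        fix m
        show "Poly_Mapping.lookup c m = Poly_Mapping.lookup d m"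
        proof (cases "m \<in> \<Lambda>")
          case True
          have "Poly_Mapping.lookup (?\<phi> c m) m = Poly_Mapping.lookup (?\<phi> d m) m"
            using fun_cong[OF eq, of m] by (rule arg_cong[where f = "\<lambda>g. Poly_Mapping.lookup g m"])
          then show ?thesis using True by (simp add: lookup_smult_pm coeff_lead)
        next
          case False
          then have "m \<notin> Poly_Mapping.keys c" "m \<notin> Poly_Mapping.keys d"
            using \<open>c \<in> ?C\<close> \<open>d \<in> ?C\<close> by auto
          then show ?thesis by (simp add: in_keys_iff)
        qed
      qed
    qed simp
  next
    fix c assume c: "c \<in> ?C"
    have "?\<phi> c i = 0" if "i \<notin> ?I" for i
      using that c \<phi>_supp[OF c] by blast
    then show "?\<phi> c \<in> ?E"
      using \<phi>_supp[OF c] unfolding external_direct_sum_def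
      by (auto intro: pm.span_scale pm.span_base)
  next
    fix f assume f: "f \<in> ?E"
    define c where "c = Abs_poly_mapping (\<lambda>m. Poly_Mapping.lookup (f m) m)"
    have "finite {m. Poly_Mapping.lookup (f m) m \<noteq> 0}"
      using f unfolding external_direct_sum_def by (auto elim!: finite_subset[rotated])
    then have c: "Poly_Mapping.lookup c m = Poly_Mapping.lookup (f m) m" for m
      by (simp add: c_def lookup_Abs_poly_mapping)
    have "f m = ?\<phi> c m" for m
    proof (cases "m \<in> ?I")
      case True
      then show ?thesis
        using f span_singleton_eq[of m "f m"] c unfolding external_direct_sum_def by auto
    next
      case False
      then have "f m = 0"
        using f unfolding external_direct_sum_def by blast
      then show ?thesis by (simp add: c)
    qed
    moreover have "c \<in> ?C"
    proof -
      have "m \<in> ?I" if "m \<in> Poly_Mapping.keys c" for m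
      proof (rule ccontr)
        assume "m \<notin> ?I"
        then have "f m = 0"
          using f unfolding external_direct_sum_def by blast
        with that show False by (simp add: in_keys_iff c)
      qed
      then show ?thesis by blast
    qed
    ultimately show "\<exists>c\<in>?C. f = ?\<phi> c" by blast
  qed
  moreover have "bij_betw (?\<sigma> \<circ> ?\<phi>) ?C (supported_part \<iota> R P)"
  proof -
    have "(?\<sigma> \<circ> ?\<phi>) c = lincomb smult_pm \<Theta> c" if "c \<in> ?C" for c
      using \<phi>_supp[OF that] by (simp add: lincomb_def)
    moreover have "inj_on (lincomb smult_pm \<Theta>) ?C"
      by (rule inj_onI, rule lincomb_inject) auto
    then have "bij_betw (lincomb smult_pm \<Theta>) ?C (supported_part \<iota> R P)"
      unfolding supported_part_eq_lincombs[OF assms] by (rule inj_on_imp_bij_betw)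
    ultimately show ?thesis
      by (subst bij_betw_cong)
  qed
  ultimately have "bij_betw ?\<sigma> ?E (supported_part \<iota> R P)"
    by (simp only: bij_betw_comp_iff[of ?\<phi> ?C ?E])
  then show ?thesis
    unfolding is_internal_direct_sum_def by (simp add: pm.subspace_span)
qed

end

section \<open>The expansion theorem\<close>

theorem proposition5p11:
  fixes \<iota> :: "'l::linordered_ab_group_add \<Rightarrow> 'v::real_vector"
    and R :: "('l \<Rightarrow>\<^sub>0 complex) set"
    and \<Lambda> :: "'l set"
    and scaleA :: "complex \<Rightarrow> 'a::ring_1 \<Rightarrow> 'a"
    and \<theta> :: "'l \<Rightarrow> 'a"
    and \<Phi> :: "'a \<Rightarrow> ('l \<Rightarrow>\<^sub>0 complex)"
    and a :: "'l \<Rightarrow> 'l \<Rightarrow> complex"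
  assumes lattice: "lattice_embedding \<iota>"
    and subalgebra: "complex_subalgebra smult_pm R"
    and algebra: "complex_algebra scaleA"
    and basis: "indexed_basis scaleA \<Lambda> \<theta>"
    and hom: "complex_algebra_hom scaleA smult_pm R \<Phi>"
    and finite_expansion: "\<And>m. m \<in> \<Lambda> \<Longrightarrow> finite {n. m < n \<and> a m n \<noteq> 0}"
    and expansion: "\<And>m. m \<in> \<Lambda> \<Longrightarrow>
      \<Phi> (\<theta> m) = Poly_Mapping.single m 1
        + (\<Sum>n | m < n \<and> a m n \<noteq> 0. Poly_Mapping.single n (a m n))"
    and leading: "\<And>g. g \<in> R \<Longrightarrow> g \<noteq> 0 \<Longrightarrow>
      lead g \<in> \<Lambda> \<and> Newt \<iota> (\<Phi> (\<theta> (lead g))) \<subseteq> Newt \<iota> g"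
  shows "complex_algebra_iso scaleA smult_pm R \<Phi>
    \<and> (\<forall>P. lattice_polytope \<iota> P \<longrightarrow>
        is_internal_direct_sum smult_pm {m \<in> \<Lambda>. Newt \<iota> (\<Phi> (\<theta> m)) \<subseteq> P}
          (\<lambda>m. module.span smult_pm {\<Phi> (\<theta> m)}) (supported_part \<iota> R P))
    \<and> (\<forall>c :: 'l \<Rightarrow>\<^sub>0 complex. Poly_Mapping.keys c \<subseteq> \<Lambda> \<longrightarrow>
        (\<Sum>m\<in>Poly_Mapping.keys c. smult_pm (Poly_Mapping.lookup c m) (\<Phi> (\<theta> m))) \<noteq> 0 \<longrightarrow>
        Newt \<iota> (\<Sum>m\<in>Poly_Mapping.keys c. smult_pm (Poly_Mapping.lookup c m) (\<Phi> (\<theta> m)))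
          = convex hull (\<Union>m\<in>Poly_Mapping.keys c. Newt \<iota> (\<Phi> (\<theta> m))))
    \<and> (\<forall>w :: 'v \<Rightarrow> real. linear w \<longrightarrow> (\<forall>c :: 'l \<Rightarrow>\<^sub>0 complex. Poly_Mapping.keys c \<subseteq> \<Lambda> \<longrightarrow>
        (\<Sum>m\<in>Poly_Mapping.keys c. smult_pm (Poly_Mapping.lookup c m) (\<Phi> (\<theta> m))) \<noteq> 0 \<longrightarrow>
        monomial_val \<iota> w (\<Sum>m\<in>Poly_Mapping.keys c. smult_pm (Poly_Mapping.lookup c m) (\<Phi> (\<theta> m)))
          = Min ((\<lambda>m. monomial_val \<iota> w (\<Phi> (\<theta> m))) ` Poly_Mapping.keys c)))"
proof -
  interpret A: complex_algebra scaleA by (rule algebra)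
  have lin: "Vector_Spaces.linear scaleA smult_pm \<Phi>" and \<Phi>_R: "\<And>x. \<Phi> x \<in> R"
    using hom unfolding complex_algebra_hom_def by auto
  define \<Theta> where "\<Theta> = (\<lambda>m. \<Phi> (\<theta> m))"
  have coeff: "Poly_Mapping.lookup (\<Theta> m) n
      = (if m = n then 1 else 0) + (if m < n then a m n else 0)" if "m \<in> \<Lambda>" for m n
  proof -
    have "(\<Sum>k | m < k \<and> a m k \<noteq> 0. if k = n then a m k else 0) = (if m < n then a m n else 0)"
      using finite_expansion[OF that] by simp
    then show ?thesis
      unfolding \<Theta>_def expansion[OF that]
      by (simp add: lookup_add lookup_sum lookup_single when_def)
  qed
  interpret newton_controlled_family \<Lambda> \<Theta> \<iota> R
  proof
    show "module.subspace smult_pm R"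
      using subalgebra unfolding complex_subalgebra_def by blast
    show "lattice_embedding \<iota>" by (rule lattice)
    show "\<Theta> m \<in> R" for m
      unfolding \<Theta>_def by (rule \<Phi>_R)
    show "lead g \<in> \<Lambda>" "Newt \<iota> (\<Theta> (lead g)) \<subseteq> Newt \<iota> g" if "g \<in> R" "g \<noteq> 0" for g
      using leading[OF that] unfolding \<Theta>_def by blast+
  qed (auto simp: coeff)
  have \<Phi>_lincomb: "\<Phi> (lincomb scaleA \<theta> c) = lincomb smult_pm \<Theta> c" for c
    unfolding \<Theta>_def by (rule linear_lincomb[OF lin])
  have "bij_betw \<Phi> UNIV R"
  proof (rule bij_betw_imageI)
    show "inj \<Phi>"
    proof (rule injI)
      fix x y assume eq: "\<Phi> x = \<Phi> y"
      have "x \<in> A.span (\<theta> ` \<Lambda>)" "y \<in> A.span (\<theta> ` \<Lambda>)"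
        using basis unfolding indexed_basis_def by auto
      then obtain c d where "Poly_Mapping.keys c \<subseteq> \<Lambda>" "x = lincomb scaleA \<theta> c"
        "Poly_Mapping.keys d \<subseteq> \<Lambda>" "y = lincomb scaleA \<theta> d"
        using span_image_lincomb[OF A.vector_space_axioms] by metis
      then show "x = y"
        using eq lincomb_inject[of c d] by (simp add: \<Phi>_lincomb)
    qed
    show "range \<Phi> = R"
    proof
      show "range \<Phi> \<subseteq> R" using \<Phi>_R by auto
      show "R \<subseteq> range \<Phi>"
      proof
        fix g assume "g \<in> R"
        then obtain c where "g = lincomb smult_pm \<Theta> c"
          using lincomb_exists_Newt by blast
        then show "g \<in> range \<Phi>" by (simp flip: \<Phi>_lincomb)
      qed
    qed
  qed
  then have "complex_algebra_iso scaleA smult_pm R \<Phi>"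
    using hom unfolding complex_algebra_iso_def by blast
  moreover have "c \<noteq> 0" if "lincomb smult_pm \<Theta> c \<noteq> 0" for c
    using that by (auto simp: lincomb_def)
  moreover have \<Phi>_\<theta>: "\<Phi> (\<theta> m) = \<Theta> m" for m
    by (simp add: \<Theta>_def)
  ultimately show ?thesis
    unfolding \<Phi>_\<theta> unfolding lincomb_def[of smult_pm \<Theta>, symmetric]
    by (simp add: supported_part_direct_sum Newt_lincomb monomial_val_lincomb)
qed

end
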